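(* Let $F$, $H$, $W$ (or $\mathbf W$ if $m>1$) satisfy the standing assumptions listed in the context, including the comparison principle, and let $u_0\in BUC(\mathbb R^d)$. Then the initial value problem $$du = F(D^2u,Du,u,x,t)\,dt+\sum_{i=1}^m H^i(Du,x)\cdot dW^i \ \text{ in } \mathbb R^d\times(0,T],\qquad u(\cdot,0)=u_0 \ \text{ on } \mathbb R^d,$$ has at most one pathwise viscosity solution in $BUC(\mathbb R^d\times[0,T])$, and it is given by the maximal sub-solution (equivalently, the minimal super-solution): if $u\in BUC(\mathbb R^d\times[0,T])$ is a solution, then for all $(x,t)\in\mathbb R^d\times[0,T]$, $$u(x,t)=\sup\{v(x,t): v \text{ is a sub-solution}\}=\inf\{v(x,t): v\text{ is a super-solution}\}.$$
   Context: Notation. $S^d$ is the space of symmetric $d\times d$ matrices with its usual order; $BUC$, $USC$, $LSC$ denote bounded uniformly continuous, upper-semicontinuous and lower-semicontinuous functions; $C^k_b(\Omega)$ is the space of functions with bounded continuous derivatives through order $k$. Intervals $(t_0-h,t_0+h)$ are understood to be intersected with $[0,T]$. Standing assumptions. $T>0$, $d,m\ge 1$. (1) $F:S^d\times\mathbb R^d\times\mathbb R\times\mathbb R^d\times[0,T]\to\mathbb R$, $F=F(X,p,r,x,t)$, is continuous, bounded on $\{(X,p,r)\in B\}\times\mathbb R^d\times[0,T]$ for every bounded set $B$, nondecreasing in $X$, nonincreasing in $r$. (2) $H=(H^1,\dots,H^m):\mathbb R^d\times\mathbb R^d\to\mathbb R^m$, $H=H(p,x)$; if $m=1$, $H\in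 C^2_b(B_R(0)\times\mathbb R^d)$ for all $R>0$; if $m>1$, $H\in C^4_b(\mathbb R^d\times\mathbb R^d;\mathbb R^m)$. (3) $W\in C([0,T],\mathbb R^m)$, $W(0)=0$; if $m>1$, there are $\alpha\in(\frac13,\frac12]$ and $\mathbb W:[0,T]^2\to\mathbb R^m\otimes\mathbb R^m$ such that $\mathbf W=(W,\mathbb W)$ is an $\alpha$-Hölder geometric rough path: $\sup_{s\neq t}\frac{|W_s-W_t|}{|s-t|^\alpha}+\sup_{s\ne t}\frac{|\mathbb W_{st}|}{|s-t|^{2\alpha}}<\infty$, $\mathbb W_{st}-\mathbb W_{su}-\mathbb W_{ut}=(W_u-W_s)\otimes(W_t-W_u)$, and the symmetric part of $\mathbb W_{st}$ equals $\frac12(W_t-W_s)\otimes(W_t-W_s)$. Differential equations and integrals against $dW$ are then in the rough path sense. (4) Comparison principle (assumed): if $u\in USC(\mathbb R^d\times[0,T])$ and $v\in LSC(\mathbb R^d\times[0,T])$ are respectively a sub- and a super-solution (defined below), then for all $t\in(0,T]$, $\sup_{x}(u(x,t)-v(x,t))_+\le\sup_x(u(x,0)-v(x,0))_+$. Solution operator. For $t_0\in[0,T]$ let $(X,P)(x,p,t)$ solve $dX=-\sum_i D_pH^i(P,X)\cdot dW^i$, $dP=\sum_i D_xH^i(P,X)\cdot dW^i$, $X(x,p,t_0)=x$, $P(x,p,t_0)=p$. When $m=1$ this means $(X,P)(x,p,t)=(\tilde X,\tilde P)(x,p,W_t-W_{t_0})$, where $\frac{d}{d\tau}\tilde X=-D_pH(\tilde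 P,\tilde X)$, $\frac{d}{d\tau}\tilde P=D_xH(\tilde P,\tilde X)$, $(\tilde X,\tilde P)(x,p,0)=(x,p)$. For $\phi\in C^2_b(\mathbb R^d)$ set $\mathbf X(x,t)=X(x,D\phi(x),t)$, $\mathbf P(x,t)=P(x,D\phi(x),t)$, and $\mathbf Z(x,t)=\phi(x)+\sum_i\int_{t_0}^t(H^i(\mathbf P,\mathbf X)-\mathbf P\cdot D_pH^i(\mathbf P,\mathbf X))(x,s)\cdot dW^i_s$ (when $m=1$: $\mathbf Z(x,t)=\phi(x)+\int_0^{W_t-W_{t_0}}(H(\tilde P,\tilde X)-\tilde P\cdot D_pH(\tilde P,\tilde X))(x,D\phi(x),\tau)\,d\tau$). For all sufficiently small $h>0$ and $t\in(t_0-h,t_0+h)$, $x\mapsto\mathbf X(x,t)$ is a bijection of $\mathbb R^d$, it and its inverse being $C^1$ with bounded first derivatives and depending continuously on $t$; for such $h$ one defines $S(t,t_0)\phi(x):=\mathbf Z(\mathbf X^{-1}(x,t),t)$, which lies in $C^2_b(\mathbb R^d)$. "$S(t,t_0)\phi\in C^2_b(\mathbb R^d)$ for $t\in(t_0-h,t_0+h)$" means that $h$ is small in this sense. Definition of solutions. $u\in USC(\mathbb R^d\times[0,T])$ (resp. $LSC$) is a (pathwise viscosity) sub-solution (resp. super-solution) of the initial value problem if $u$ is bounded from above (resp. below), $u(\cdot,0)\le u_0$ (resp. $\ge u_0$), and whenever $t_0\in(0,T]$, $\phi\in C^2_b(\mathbb R^d)$, $\psi\in C^1([0,T])$, $h>0$,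 $S(t,t_0)\phi\in C^2_b(\mathbb R^d)$ for $t\in(t_0-h,t_0+h)$, and $u(x,t)-S(t,t_0)\phi(x)-\psi(t)$ attains a local maximum (resp. minimum) at $(x_0,t_0)$ in $\mathbb R^d\times(t_0-h,t_0+h)$, then $\psi'(t_0)\le F(D^2\phi(x_0),D\phi(x_0),u(x_0,t_0),x_0,t_0)$ (resp. $\ge$). A solution is both a sub- and a super-solution. *)

theory Defs
  imports "HOL-Analysis.Analysis"
begin

section \<open>Function spaces\<close>

text \<open>
  \<open>Cb k A f\<close>: on the open set \<open>A\<close>, all partial derivatives of \<open>f\<close> of order \<open>0, \<dots>, k\<close> exist and are
  bounded and continuous (order 0 being \<open>f\<close> itself).
\<close>
primrec Cb :: "nat \<Rightarrow> 'a::euclidean_space set \<Rightarrow> ('a \<Rightarrow> 'b::real_normed_vector) \<Rightarrow> bool" where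
  "Cb 0 A f \<longleftrightarrow> continuous_on A f \<and> bounded (f ` A)"
| "Cb (Suc k) A f \<longleftrightarrow> continuous_on A f \<and> bounded (f ` A) \<and>
     (\<forall>x\<in>A. f differentiable (at x)) \<and>
     (\<forall>b\<in>Basis. Cb k A (\<lambda>x. frechet_derivative f (at x) b))"

definition C1_on_interval :: "real \<Rightarrow> (real \<Rightarrow> real) \<Rightarrow> (real \<Rightarrow> real) \<Rightarrow> bool" where
  "C1_on_interval T \<psi> \<psi>' \<longleftrightarrow>
     (\<forall>t\<in>{0..T}. (\<psi> has_real_derivative \<psi>' t) (at t within {0..T})) \<and> continuous_on {0..T} \<psi>'"

definition BUC :: "'a::metric_space set \<Rightarrow> ('a \<Rightarrow> real) \<Rightarrow> bool" where
  "BUC A u \<longleftrightarrow> uniformly_continuous_on A u \<and> bounded (u ` A)"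

definition USC :: "'a::topological_space set \<Rightarrow> ('a \<Rightarrow> real) \<Rightarrow> bool" where
  "USC A u \<longleftrightarrow> (\<forall>z\<in>A. \<forall>c>u z. \<forall>\<^sub>F y in at z within A. u y < c)"

definition LSC :: "'a::topological_space set \<Rightarrow> ('a \<Rightarrow> real) \<Rightarrow> bool" where
  "LSC A u \<longleftrightarrow> (\<forall>z\<in>A. \<forall>c<u z. \<forall>\<^sub>F y in at z within A. c < u y)"

definition local_max_on :: "'a::topological_space set \<Rightarrow> ('a \<Rightarrow> real) \<Rightarrow> 'a \<Rightarrow> bool" where
  "local_max_on A f z \<longleftrightarrow> z \<in> A \<and> (\<forall>\<^sub>F y in at z within A. f y \<le> f z)"

definition local_min_on :: "'a::topological_space set \<Rightarrow> ('a \<Rightarrow> real) \<Rightarrow> 'a \<Rightarrow> bool" where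
  "local_min_on A f z \<longleftrightarrow> z \<in> A \<and> (\<forall>\<^sub>F y in at z within A. f z \<le> f y)"

definition grad :: "(real^'d \<Rightarrow> real) \<Rightarrow> real^'d \<Rightarrow> real^'d" where
  "grad f x = (\<chi> i. frechet_derivative f (at x) (axis i 1))"

definition hess :: "(real^'d \<Rightarrow> real) \<Rightarrow> real^'d \<Rightarrow> real^'d^'d" where
  "hess f x = jacobian (grad f) (at x)"

definition sym_mats :: "(real^'d^'d) set" where
  "sym_mats = {A. transpose A = A}"

definition psd_le :: "real^'d^'d \<Rightarrow> real^'d^'d \<Rightarrow> bool" where
  "psd_le A B \<longleftrightarrow> (\<forall>\<xi>. \<xi> \<bullet> (A *v \<xi>) \<le> \<xi> \<bullet> (B *v \<xi>))"

section \<open>Standing assumptions on the data\<close>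

definition nonlinearity :: "real \<Rightarrow>
    (real^'d^'d \<Rightarrow> real^'d \<Rightarrow> real \<Rightarrow> real^'d \<Rightarrow> real \<Rightarrow> real) \<Rightarrow> bool" where
  "nonlinearity T F \<longleftrightarrow>
     continuous_on (sym_mats \<times> UNIV \<times> UNIV \<times> UNIV \<times> {0..T}) (\<lambda>(A, p, r, x, t). F A p r x t) \<and>
     (\<forall>B \<subseteq> sym_mats \<times> UNIV \<times> UNIV. bounded B \<longrightarrow>
        bounded {F A p r x t | A p r x t. (A, p, r) \<in> B \<and> t \<in> {0..T}}) \<and>
     (\<forall>A\<in>sym_mats. \<forall>A'\<in>sym_mats. \<forall>p r x. \<forall>t\<in>{0..T}. psd_le A A' \<longrightarrow> F A p r x t \<le> F A' p r x t) \<and>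
     (\<forall>A\<in>sym_mats. \<forall>p r r' x. \<forall>t\<in>{0..T}. r \<le> r' \<longrightarrow> F A p r' x t \<le> F A p r x t)"

definition hamiltonian :: "(real^'d \<Rightarrow> real^'d \<Rightarrow> real^'m) \<Rightarrow> bool" where
  "hamiltonian H \<longleftrightarrow>
     (if CARD('m) = 1
      then \<forall>R>0. Cb 2 (ball 0 R \<times> UNIV) (\<lambda>(p, x). H p x)
      else Cb 4 UNIV (\<lambda>(p, x). H p x))"

definition tensor :: "real^'m \<Rightarrow> real^'m \<Rightarrow> real^'m^'m" where
  "tensor a b = (\<chi> i j. a $ i * b $ j)"

text \<open>\<open>WW s t $ i $ j\<close> stands for the iterated integral of \<open>W\<^sup>i\<close> against \<open>dW\<^sup>j\<close> over \<open>[s, t]\<close>.\<close>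
definition geometric_rough_path ::
    "real \<Rightarrow> real \<Rightarrow> (real \<Rightarrow> real^'m) \<Rightarrow> (real \<Rightarrow> real \<Rightarrow> real^'m^'m) \<Rightarrow> bool" where
  "geometric_rough_path \<alpha> T W WW \<longleftrightarrow>
     (\<exists>C. \<forall>s\<in>{0..T}. \<forall>t\<in>{0..T}. s \<noteq> t \<longrightarrow>
        norm (W s - W t) / \<bar>s - t\<bar> powr \<alpha> + norm (WW s t) / \<bar>s - t\<bar> powr (2 * \<alpha>) \<le> C) \<and>
     (\<forall>s\<in>{0..T}. \<forall>u\<in>{0..T}. \<forall>t\<in>{0..T}.
        WW s t - WW s u - WW u t = tensor (W u - W s) (W t - W u)) \<and>
     (\<forall>s\<in>{0..T}. \<forall>t\<in>{0..T}.
        (1/2) *\<^sub>R (WW s t + transpose (WW s t)) = (1/2) *\<^sub>R tensor (W t - W s) (W t - W s))"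

definition driving_path ::
    "real \<Rightarrow> real \<Rightarrow> (real \<Rightarrow> real^'m) \<Rightarrow> (real \<Rightarrow> real \<Rightarrow> real^'m^'m) \<Rightarrow> bool" where
  "driving_path \<alpha> T W WW \<longleftrightarrow> continuous_on {0..T} W \<and> W 0 = 0 \<and>
     (CARD('m) > 1 \<longrightarrow> 1/3 < \<alpha> \<and> \<alpha> \<le> 1/2 \<and> geometric_rough_path \<alpha> T W WW)"

section \<open>Rough integrals and rough differential equations\<close>

text \<open>
  \<open>Y' i\<close> is the Gubinelli derivative of \<open>Y\<close> in the direction \<open>W\<^sup>i\<close>.
\<close>
definition controlled_path :: "real \<Rightarrow> (real \<Rightarrow> real^'m) \<Rightarrow> real set \<Rightarrow>
    (real \<Rightarrow> 'e::real_normed_vector) \<Rightarrow> ('m \<Rightarrow> real \<Rightarrow> 'e) \<Rightarrow> bool" where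
  "controlled_path \<alpha> W I Y Y' \<longleftrightarrow> (\<exists>C. \<forall>s\<in>I. \<forall>t\<in>I.
     (\<forall>i. norm (Y' i t - Y' i s) \<le> C * \<bar>t - s\<bar> powr \<alpha>) \<and>
     norm (Y t - Y s - (\<Sum>i\<in>UNIV. (W t - W s) $ i *\<^sub>R Y' i s)) \<le> C * \<bar>t - s\<bar> powr (2 * \<alpha>))"

text \<open>
  \<open>J\<close> is the integral of \<open>\<Sum>\<^sub>j Y j dW\<^sup>j\<close> over \<open>[s, t]\<close>, i.e. the limit of the compensated Riemann sums along
  partitions of vanishing mesh; \<open>Y' i j\<close> is the Gubinelli derivative of \<open>Y j\<close> in the direction \<open>W\<^sup>i\<close>.
\<close>
definition has_rough_integral :: "(real \<Rightarrow> real^'m) \<Rightarrow> (real \<Rightarrow> real \<Rightarrow> real^'m^'m) \<Rightarrow>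
    ('m \<Rightarrow> real \<Rightarrow> 'e::real_normed_vector) \<Rightarrow> ('m \<Rightarrow> 'm \<Rightarrow> real \<Rightarrow> 'e) \<Rightarrow> real \<Rightarrow> real \<Rightarrow> 'e \<Rightarrow> bool" where
  "has_rough_integral W WW Y Y' s t J \<longleftrightarrow>
     (\<forall>\<epsilon>>0. \<exists>\<delta>>0. \<forall>(n::nat) (\<pi>::nat \<Rightarrow> real).
        \<pi> 0 = s \<and> \<pi> n = t \<and> (\<forall>k<n. \<pi> k < \<pi> (Suc k) \<and> \<pi> (Suc k) - \<pi> k < \<delta>) \<longrightarrow>
        norm ((\<Sum>k<n. (\<Sum>j\<in>UNIV. (W (\<pi> (Suc k)) - W (\<pi> k)) $ j *\<^sub>R Y j (\<pi> k)) +
                      (\<Sum>i\<in>UNIV. \<Sum>j\<in>UNIV. (WW (\<pi> k) (\<pi> (Suc k)) $ i $ j) *\<^sub>R Y' i j (\<pi> k))) - J) < \<epsilon>)"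

text \<open>
  \<open>dY = \<Sum>\<^sub>i V i (Y) dW\<^sup>i\<close> on the interval \<open>I\<close>.
\<close>
definition rde_solution :: "real \<Rightarrow> (real \<Rightarrow> real^'m) \<Rightarrow> (real \<Rightarrow> real \<Rightarrow> real^'m^'m) \<Rightarrow> real set \<Rightarrow>
    ('m \<Rightarrow> 'e::real_normed_vector \<Rightarrow> 'e) \<Rightarrow> (real \<Rightarrow> 'e) \<Rightarrow> bool" where
  "rde_solution \<alpha> W WW I V Y \<longleftrightarrow>
     controlled_path \<alpha> W I Y (\<lambda>i r. V i (Y r)) \<and>
     (\<forall>s\<in>I. \<forall>t\<in>I. s \<le> t \<longrightarrow>
        has_rough_integral W WW (\<lambda>j r. V j (Y r))
          (\<lambda>i j r. frechet_derivative (V j) (at (Y r)) (V i (Y r))) s t (Y t - Y s))"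

section \<open>Characteristics and the local solution operator\<close>

definition DpH :: "(real^'d \<Rightarrow> real^'d \<Rightarrow> real^'m) \<Rightarrow> 'm \<Rightarrow> real^'d \<Rightarrow> real^'d \<Rightarrow> real^'d" where
  "DpH H i p x = grad (\<lambda>q. H q x $ i) p"

definition DxH :: "(real^'d \<Rightarrow> real^'d \<Rightarrow> real^'m) \<Rightarrow> 'm \<Rightarrow> real^'d \<Rightarrow> real^'d \<Rightarrow> real^'d" where
  "DxH H i p x = grad (\<lambda>y. H p y $ i) x"

text \<open>Characteristics are pairs \<open>(X, P)\<close>, in this order, whereas \<open>H\<close> takes \<open>p\<close> before \<open>x\<close>.\<close>
definition char_field :: "(real^'d \<Rightarrow> real^'d \<Rightarrow> real^'m) \<Rightarrow> 'm \<Rightarrow>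
    (real^'d) \<times> (real^'d) \<Rightarrow> (real^'d) \<times> (real^'d)" where
  "char_field H i = (\<lambda>(x, p). (- DpH H i p x, DxH H i p x))"

definition char_cost :: "(real^'d \<Rightarrow> real^'d \<Rightarrow> real^'m) \<Rightarrow> 'm \<Rightarrow>
    (real^'d) \<times> (real^'d) \<Rightarrow> real" where
  "char_cost H i = (\<lambda>(x, p). H p x $ i - p \<bullet> DpH H i p x)"

text \<open>
  One-dimensional driving signal \<open>w\<close>: the characteristics are the Hamiltonian flow run at the
  \<open>time\<close> \<open>w t - w t0\<close>. The flow is only required to exist on the range of these increments, since for
  \<open>m = 1\<close> the Hamiltonian need not have globally bounded derivatives. \<open>LBINT\<close> is the oriented integral.
\<close>
definition scalar_characteristic :: "('e::real_normed_vector \<Rightarrow> 'e) \<Rightarrow> ('e \<Rightarrow> real) \<Rightarrow> (real \<Rightarrow> real) \<Rightarrow>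
    real set \<Rightarrow> real \<Rightarrow> 'e \<Rightarrow> real \<Rightarrow> (real \<Rightarrow> 'e) \<Rightarrow> (real \<Rightarrow> real) \<Rightarrow> bool" where
  "scalar_characteristic V g w I t0 y z Y Z \<longleftrightarrow>
     (\<exists>Yt. Yt 0 = y \<and>
        (let J = (\<lambda>t. w t - w t0) ` I in
           \<forall>\<tau>\<in>J. (Yt has_vector_derivative V (Yt \<tau>)) (at \<tau> within J)) \<and>
        (\<forall>t\<in>I. Y t = Yt (w t - w t0) \<and>
               Z t = z + (LBINT \<tau>=0..ereal (w t - w t0). g (Yt \<tau>))))"

definition rough_characteristic :: "real \<Rightarrow> ('m \<Rightarrow> 'e::real_normed_vector \<Rightarrow> 'e) \<Rightarrow> ('m \<Rightarrow> 'e \<Rightarrow> real) \<Rightarrow>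
    (real \<Rightarrow> real^'m) \<Rightarrow> (real \<Rightarrow> real \<Rightarrow> real^'m^'m) \<Rightarrow>
    real set \<Rightarrow> real \<Rightarrow> 'e \<Rightarrow> real \<Rightarrow> (real \<Rightarrow> 'e) \<Rightarrow> (real \<Rightarrow> real) \<Rightarrow> bool" where
  "rough_characteristic \<alpha> V g W WW I t0 y z Y Z \<longleftrightarrow>
     Y t0 = y \<and> rde_solution \<alpha> W WW I V Y \<and>
     (let G = (\<lambda>j r. g j (Y r));
          G' = (\<lambda>i j r. frechet_derivative (g j) (at (Y r)) (V i (Y r)))
      in \<forall>t\<in>I. (t0 \<le> t \<longrightarrow> has_rough_integral W WW G G' t0 t (Z t - z)) \<and>
                (t \<le> t0 \<longrightarrow> has_rough_integral W WW G G' t t0 (z - Z t)))"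

text \<open>\<open>(X, P, Z)\<close> on \<open>I\<close>, started at time \<open>t0\<close> from \<open>(x, p, z)\<close>. If \<open>CARD('m) = 1\<close> then the index
  \<open>i\<close> below is unique.\<close>
definition characteristic :: "real \<Rightarrow> (real^'d \<Rightarrow> real^'d \<Rightarrow> real^'m) \<Rightarrow>
    (real \<Rightarrow> real^'m) \<Rightarrow> (real \<Rightarrow> real \<Rightarrow> real^'m^'m) \<Rightarrow> real set \<Rightarrow> real \<Rightarrow>
    real^'d \<Rightarrow> real^'d \<Rightarrow> real \<Rightarrow> (real \<Rightarrow> real^'d) \<Rightarrow> (real \<Rightarrow> real^'d) \<Rightarrow> (real \<Rightarrow> real) \<Rightarrow> bool" where
  "characteristic \<alpha> H W WW I t0 x p z X P Z \<longleftrightarrow>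
     (if CARD('m) = 1
      then \<forall>i. scalar_characteristic (char_field H i) (char_cost H i) (\<lambda>t. W t $ i) I t0
                 (x, p) z (\<lambda>t. (X t, P t)) Z
      else rough_characteristic \<alpha> (char_field H) (char_cost H) W WW I t0
                 (x, p) z (\<lambda>t. (X t, P t)) Z)"

text \<open>\<open>f (\<cdot>, t)\<close> is, for \<open>t \<in> I\<close>, a \<open>C\<^sup>1\<close> map with bounded first derivatives, and \<open>f (\<cdot>, t)\<close> depends continuously
  on \<open>t\<close> (locally uniformly in \<open>C\<^sup>1\<close>, which amounts to joint continuity of \<open>f\<close> and \<open>D\<^sub>x f\<close>).\<close>
definition C1_family :: "real set \<Rightarrow> (real^'d \<Rightarrow> real \<Rightarrow> real^'d) \<Rightarrow> bool" where
  "C1_family I f \<longleftrightarrow>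
     (\<forall>t\<in>I. (\<forall>x. (\<lambda>y. f y t) differentiable (at x)) \<and>
             bounded (range (\<lambda>x. jacobian (\<lambda>y. f y t) (at x)))) \<and>
     continuous_on (UNIV \<times> I) (\<lambda>(x, t). f x t) \<and>
     continuous_on (UNIV \<times> I) (\<lambda>(x, t). jacobian (\<lambda>y. f y t) (at x))"

definition time_window :: "real \<Rightarrow> real \<Rightarrow> real \<Rightarrow> real set" where
  "time_window T t0 h = {t0 - h<..<t0 + h} \<inter> {0..T}"

text \<open>
  \<open>h\<close> is small enough for \<open>S(t, t0)\<phi>\<close> to be defined and to belong to \<open>C\<^sup>2\<^sub>b\<close> for \<open>t\<close> within \<open>h\<close> of \<open>t0\<close>,
  and \<open>S t = S(t, t0)\<phi>\<close> for these \<open>t\<close>. Values of \<open>S t\<close> for other \<open>t\<close> are irrelevant.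
\<close>
definition local_solution_operator :: "real \<Rightarrow> (real^'d \<Rightarrow> real^'d \<Rightarrow> real^'m) \<Rightarrow>
    (real \<Rightarrow> real^'m) \<Rightarrow> (real \<Rightarrow> real \<Rightarrow> real^'m^'m) \<Rightarrow> real \<Rightarrow> real \<Rightarrow> real \<Rightarrow>
    (real^'d \<Rightarrow> real) \<Rightarrow> (real \<Rightarrow> real^'d \<Rightarrow> real) \<Rightarrow> bool" where
  "local_solution_operator \<alpha> H W WW T t0 h \<phi> S \<longleftrightarrow>
     (let I = time_window T t0 h in
      \<exists>X P Z.
        (\<forall>x. characteristic \<alpha> H W WW I t0 x (grad \<phi> x) (\<phi> x) (X x) (P x) (Z x)) \<and>
        (\<forall>t\<in>I. bij (\<lambda>x. X x t)) \<and>
        C1_family I X \<and>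
        C1_family I (\<lambda>y t. inv (\<lambda>x. X x t) y) \<and>
        (\<forall>t\<in>I. \<forall>x. S t x = Z (inv (\<lambda>y. X y t) x) t) \<and>
        (\<forall>t\<in>I. Cb 2 UNIV (S t)))"

section \<open>Pathwise viscosity solutions\<close>

definition subsolution :: "(real^'d^'d \<Rightarrow> real^'d \<Rightarrow> real \<Rightarrow> real^'d \<Rightarrow> real \<Rightarrow> real) \<Rightarrow>
    real \<Rightarrow> (real^'d \<Rightarrow> real^'d \<Rightarrow> real^'m) \<Rightarrow> (real \<Rightarrow> real^'m) \<Rightarrow> (real \<Rightarrow> real \<Rightarrow> real^'m^'m) \<Rightarrow>
    real \<Rightarrow> (real^'d \<Rightarrow> real) \<Rightarrow> ((real^'d) \<times> real \<Rightarrow> real) \<Rightarrow> bool" where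
  "subsolution F \<alpha> H W WW T u0 u \<longleftrightarrow>
     USC (UNIV \<times> {0..T}) u \<and> bdd_above (u ` (UNIV \<times> {0..T})) \<and> (\<forall>x. u (x, 0) \<le> u0 x) \<and>
     (\<forall>t0\<in>{0<..T}. \<forall>\<phi> \<psi> \<psi>' h S x0.
        Cb 2 UNIV \<phi> \<and> C1_on_interval T \<psi> \<psi>' \<and> h > 0 \<and>
        local_solution_operator \<alpha> H W WW T t0 h \<phi> S \<and>
        local_max_on (UNIV \<times> time_window T t0 h) (\<lambda>(x, t). u (x, t) - S t x - \<psi> t) (x0, t0) \<longrightarrow>
        \<psi>' t0 \<le> F (hess \<phi> x0) (grad \<phi> x0) (u (x0, t0)) x0 t0)"

definition supersolution :: "(real^'d^'d \<Rightarrow> real^'d \<Rightarrow> real \<Rightarrow> real^'d \<Rightarrow> real \<Rightarrow> real) \<Rightarrow>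
    real \<Rightarrow> (real^'d \<Rightarrow> real^'d \<Rightarrow> real^'m) \<Rightarrow> (real \<Rightarrow> real^'m) \<Rightarrow> (real \<Rightarrow> real \<Rightarrow> real^'m^'m) \<Rightarrow>
    real \<Rightarrow> (real^'d \<Rightarrow> real) \<Rightarrow> ((real^'d) \<times> real \<Rightarrow> real) \<Rightarrow> bool" where
  "supersolution F \<alpha> H W WW T u0 u \<longleftrightarrow>
     LSC (UNIV \<times> {0..T}) u \<and> bdd_below (u ` (UNIV \<times> {0..T})) \<and> (\<forall>x. u0 x \<le> u (x, 0)) \<and>
     (\<forall>t0\<in>{0<..T}. \<forall>\<phi> \<psi> \<psi>' h S x0.
        Cb 2 UNIV \<phi> \<and> C1_on_interval T \<psi> \<psi>' \<and> h > 0 \<and>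
        local_solution_operator \<alpha> H W WW T t0 h \<phi> S \<and>
        local_min_on (UNIV \<times> time_window T t0 h) (\<lambda>(x, t). u (x, t) - S t x - \<psi> t) (x0, t0) \<longrightarrow>
        \<psi>' t0 \<ge> F (hess \<phi> x0) (grad \<phi> x0) (u (x0, t0)) x0 t0)"

definition solution :: "(real^'d^'d \<Rightarrow> real^'d \<Rightarrow> real \<Rightarrow> real^'d \<Rightarrow> real \<Rightarrow> real) \<Rightarrow>
    real \<Rightarrow> (real^'d \<Rightarrow> real^'d \<Rightarrow> real^'m) \<Rightarrow> (real \<Rightarrow> real^'m) \<Rightarrow> (real \<Rightarrow> real \<Rightarrow> real^'m^'m) \<Rightarrow>
    real \<Rightarrow> (real^'d \<Rightarrow> real) \<Rightarrow> ((real^'d) \<times> real \<Rightarrow> real) \<Rightarrow> bool" where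
  "solution F \<alpha> H W WW T u0 u \<longleftrightarrow>
     subsolution F \<alpha> H W WW T u0 u \<and> supersolution F \<alpha> H W WW T u0 u"

text \<open>
  The two functions need not share an initial datum: a sub-solution of the equation is one of the
  initial value problem for any \<open>u0\<close> above its initial value, and symmetrically for super-solutions.
  (One may always take constants, so \<open>BUC\<close> data lose nothing.) Both suprema are over sets that are
  bounded above.
\<close>
definition comparison_principle :: "(real^'d^'d \<Rightarrow> real^'d \<Rightarrow> real \<Rightarrow> real^'d \<Rightarrow> real \<Rightarrow> real) \<Rightarrow>
    real \<Rightarrow> (real^'d \<Rightarrow> real^'d \<Rightarrow> real^'m) \<Rightarrow> (real \<Rightarrow> real^'m) \<Rightarrow> (real \<Rightarrow> real \<Rightarrow> real^'m^'m) \<Rightarrow>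
    real \<Rightarrow> bool" where
  "comparison_principle F \<alpha> H W WW T \<longleftrightarrow>
     (\<forall>u0 v0 u v. BUC UNIV u0 \<and> BUC UNIV v0 \<and>
        subsolution F \<alpha> H W WW T u0 u \<and> supersolution F \<alpha> H W WW T v0 v \<longrightarrow>
        (\<forall>t\<in>{0<..T}. (SUP x. max 0 (u (x, t) - v (x, t))) \<le> (SUP x. max 0 (u (x, 0) - v (x, 0)))))"

end

theory Submission
  imports Defs
begin

text \<open>Everything follows from one inequality, \<open>subsolution_le_supersolution\<close>: for
  the same datum \<open>u0\<close>, every sub-solution lies below every super-solution on all of
  [0,T]. At time 0 both are separated by \<open>u0\<close>, so the right side of the comparison
  principle is zero. A solution is of both kinds, so two solutions bound each other and coincide;
  and a solution is an upper bound of the sub-solutions while being one itself, so it is their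
  maximum, and dually the minimum of the super-solutions.\<close>

lemma subsolution_le_supersolution:
  assumes comp: "comparison_principle F \<alpha> H W WW T" and u0: "BUC UNIV u0"
    and u: "subsolution F \<alpha> H W WW T u0 u" and v: "supersolution F \<alpha> H W WW T u0 v"
    and t: "t \<in> {0..T}"
  shows "u (x, t) \<le> v (x, t)"
proof -
  have "u (y, 0) \<le> v (y, 0)" for y
  proof (rule order_trans)
    show "u (y, 0) \<le> u0 y"
      using u unfolding subsolution_def by (elim conjE) (erule spec)
    show "u0 y \<le> v (y, 0)"
      using v unfolding supersolution_def by (elim conjE) (erule spec)
  qed
  then have initial: "max 0 (u (y, 0) - v (y, 0)) = 0" for y
    by (simp add: max_absorb1)
  show ?thesis
  \<comment> \<open>The comparison principle speaks only of positive times, so time 0 is settled by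
    the initial data directly.\<close>
  proof (cases "t = 0")
    case True
    with initial[of x] show ?thesis by simp
  next
    case False
    \<comment> \<open>A real-valued \<open>SUP\<close> dominates its members only over a set bounded
      above. The one-sided bounds on \<open>u\<close> and \<open>v\<close> provide this.\<close>
    obtain a where a: "\<And>z. z \<in> UNIV \<times> {0..T} \<Longrightarrow> u z \<le> a"
      using u[unfolded subsolution_def, THEN conjunct2, THEN conjunct1] by (auto simp: bdd_above_def)
    obtain b where b: "\<And>z. z \<in> UNIV \<times> {0..T} \<Longrightarrow> b \<le> v z"
      using v[unfolded supersolution_def, THEN conjunct2, THEN conjunct1] by (auto simp: bdd_below_def)
    have "max 0 (u (y, t) - v (y, t)) \<le> max 0 (a - b)" for y
      using a[of "(y, t)"] b[of "(y, t)"] t by auto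
    then have bdd: "bdd_above (range (\<lambda>y. max 0 (u (y, t) - v (y, t))))"
      by (rule bdd_above.I2)
    have "max 0 (u (x, t) - v (x, t)) \<le> (SUP y. max 0 (u (y, t) - v (y, t)))"
      using bdd by (rule cSUP_upper[rotated]) simp
    also have "\<dots> \<le> (SUP y. max 0 (u (y, 0) - v (y, 0)))"
      \<comment> \<open>The principle allows two different data; here both are
        \<open>u0\<close>.\<close>
      using comp[unfolded comparison_principle_def, rule_format, of u0 u0 u v t] u0 u v t False
      by auto
    also have "\<dots> = 0"
      unfolding initial by simp
    finally show ?thesis by simp
  qed
qed

theorem theorem1p1:
  fixes F :: "real^'d^'d \<Rightarrow> real^'d \<Rightarrow> real \<Rightarrow> real^'d \<Rightarrow> real \<Rightarrow> real"
    and H :: "real^'d \<Rightarrow> real^'d \<Rightarrow> real^'m"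
    and W :: "real \<Rightarrow> real^'m"
    and WW :: "real \<Rightarrow> real \<Rightarrow> real^'m^'m"
    and \<alpha> T :: real
    and u0 :: "real^'d \<Rightarrow> real"
  assumes "T > 0"
    and "nonlinearity T F"
    and "hamiltonian H"
    and "driving_path \<alpha> T W WW"
    and "comparison_principle F \<alpha> H W WW T"
    and "BUC UNIV u0"
  shows "(\<forall>u v. BUC (UNIV \<times> {0..T}) u \<and> solution F \<alpha> H W WW T u0 u \<and>
                BUC (UNIV \<times> {0..T}) v \<and> solution F \<alpha> H W WW T u0 v \<longrightarrow>
                (\<forall>x. \<forall>t\<in>{0..T}. u (x, t) = v (x, t))) \<and>
         (\<forall>u. BUC (UNIV \<times> {0..T}) u \<and> solution F \<alpha> H W WW T u0 u \<longrightarrow>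
              (\<forall>x. \<forall>t\<in>{0..T}.
                 ereal (u (x, t)) = (SUP v\<in>{v. subsolution F \<alpha> H W WW T u0 v}. ereal (v (x, t))) \<and>
                 ereal (u (x, t)) = (INF v\<in>{v. supersolution F \<alpha> H W WW T u0 v}. ereal (v (x, t)))))"
proof (intro conjI allI ballI impI; (elim conjE)?)
  note le = subsolution_le_supersolution[OF assms(5,6)]
  fix u v x t
  assume "solution F \<alpha> H W WW T u0 u" "solution F \<alpha> H W WW T u0 v" "t \<in> {0..T}"
  then show "u (x, t) = v (x, t)"
    \<comment> \<open>Comparison is used twice, with the roles of \<open>u\<close> and
      \<open>v\<close> exchanged.\<close>
    unfolding solution_def by (blast intro: le antisym)
next
  note le = subsolution_le_supersolution[OF assms(5,6)]
  fix u x t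
  assume u: "solution F \<alpha> H W WW T u0 u" and t: "t \<in> {0..T}"
  show "ereal (u (x, t)) = (SUP v\<in>{v. subsolution F \<alpha> H W WW T u0 v}. ereal (v (x, t)))"
    \<comment> \<open>As a sub-solution, \<open>u\<close> is itself a competitor, giving \<le>; as a
      super-solution it dominates all competitors, giving the converse.\<close>
    using u t unfolding solution_def
    by (intro antisym SUP_upper2[of u] SUP_least) (auto intro: le)
  show "ereal (u (x, t)) = (INF v\<in>{v. supersolution F \<alpha> H W WW T u0 v}. ereal (v (x, t)))"
    using u t unfolding solution_def
    by (intro antisym INF_lower2[of u] INF_greatest) (auto intro: le)
qed

end
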